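(* Let $k\ge 1$ be an integer, $T>0$, and for $1\le i\le k$ let $\beta_i:[0,T]\to[\beta_{\min},\beta_{\max}]$ and $\nu_i:[0,T]\to[\nu_{\min},\nu_{\max}]$ be continuous functions, where $0<\beta_{\min}<\beta_{\max}<\infty$ and $0<\nu_{\min}<\nu_{\max}<\infty$ are constants independent of $i$. Let $(\Omega,\mathscr{F})$ be a measurable space carrying a $k$-dimensional vector of counting processes $N_t=(N_t(1),\dots,N_t(k))$, $t\in[0,T]$, and let $\mathscr{F}^N_t=\sigma(N_s:0\le s\le t)$. Let $\mathbb{P}_0$ and $\mathbb{P}_1$ be probability measures on $(\Omega,\mathscr{F})$ such that, under $\mathbb{P}_0$, the $N_t(i)$, $1\le i\le k$, are independent $\mathscr{F}^N_t$-Poisson processes over $[0,T]$ with intensities $\beta_i(t)$, respectively, and, under $\mathbb{P}_1$, the $N_t(i)$, $1\le i\le k$, are independent $\mathscr{F}^N_t$-Poisson processes over $[0,T]$ with intensities $\beta_i(t)+\nu_i(t)$, respectively. For $1\le i\le k$ let $(\tau_n(i):n\ge 1)$ be the jump times of $t\mapsto N_t(i)$, and define \[ L_T(i)=\exp\left(-\int_0^T\nu_i(s)\,ds\right)\prod_{n=1}^{N_T(i)}\left(1+\frac{\nu_i(\tau_n(i))}{\beta_i(\tau_n(i))}\right),\qquad L_T=\prod_{i=1}^k L_T(i). \] (Thus $L_T(i)$ is computed on the basis of the path $t\mapsto N_t(i)$, $t\in[0,T]$, observed at sensor $i$ only.) Let $\alpha\in(0,1)$ and let $\gamma>0$ satisfy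 $\mathbb{P}_0(L_T\ge\gamma)=\alpha$. Then the test $A_1^*=\{L_T\ge\gamma\}$ is optimal for $\mathscr{F}^N_T$-observations in the sense that for any $A_1\in\mathscr{F}^N_T$ with $\mathbb{P}_0(A_1)\le\alpha$ we have $\mathbb{P}_1(A_1^* )\ge\mathbb{P}_1(A_1)$.
   Context: $\mathbb{Z}^+=\{0,1,2,\dots\}$. A counting process is a $\mathbb{Z}^+$-valued process with value $0$ at time $0$ whose sample paths are non-decreasing, piecewise constant, right-continuous, and increase in steps of size one; its jump times $\tau_1<\tau_2<\cdots$ are the successive times at which it increases. Empty products equal $1$. Given a probability measure $\mathbb{P}$ and a filtration $(\mathscr{F}_t)$, an $(\mathscr{F}_t)$-adapted counting process $X_t$ is a $(\mathbb{P},\mathscr{F}_t)$-Poisson process over $[0,T]$ with (deterministic) intensity $\lambda(t)$ (nonnegative, measurable, integrable on $[0,T]$) if for all $0\le s\le t\le T$: (1) $X_t-X_s$ is independent of $\mathscr{F}_s$ under $\mathbb{P}$, and (2) under $\mathbb{P}$, $X_t-X_s$ is a Poisson random variable with parameter $\int_s^t\lambda(u)\,du$. Interpretation: $N_t(i)$ is the number of counts registered at sensor $i$ up to time $t$; $\mathbb{P}_0$ and $\mathbb{P}_1$ correspond to hypotheses $H_0$ and $H_1$. A test is a set $A_1\in\mathscr{F}^N_T$ (decide $H_1$ if $\omega\in A_1$, otherwise $H_0$); its probability of false alarm is $\mathbb{P}_0(A_1)$ and its probability of detection is $\mathbb{P}_1(A_1)$. Sensor $i$ transmits $L_T(i)$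 at time $T$ to a fusion center, which forms $L_T$ and performs the test $A_1^*$. *)

theory Defs
  imports "HOL-Probability.Probability"
begin

definition increases_at :: "(real \<Rightarrow> nat) \<Rightarrow> real \<Rightarrow> bool" where
  "increases_at x t \<longleftrightarrow> (\<forall>\<^sub>F s in at_left t. x s < x t)"

(* nat carries the discrete topology, so right-continuity at t says that x is constant on
   some [t, t + e). *)
definition counting_path :: "real \<Rightarrow> (real \<Rightarrow> nat) \<Rightarrow> bool" where
  "counting_path T x \<longleftrightarrow>
     x 0 = 0 \<and>
     mono_on {0..T} x \<and>
     (\<exists>S. finite S \<and> (\<forall>a b. {a..b} \<subseteq> {0..T} - S \<longrightarrow> x constant_on {a..b})) \<and>
     (\<forall>t\<in>{0..<T}. continuous (at_right t) x) \<and>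
     (\<forall>t\<in>{0<..T}. increases_at x t \<longrightarrow> (\<forall>\<^sub>F s in at_left t. x t = x s + 1))"

(* jump_time T x n is the n-th jump time for 1 \<le> n \<le> x T; index 0 is only the start of the
   recursion, and the value is unspecified for n > x T. *)
primrec jump_time :: "real \<Rightarrow> (real \<Rightarrow> nat) \<Rightarrow> nat \<Rightarrow> real" where
  "jump_time T x 0 = 0"
| "jump_time T x (Suc n) = (LEAST t. t \<in> {jump_time T x n<..T} \<and> increases_at x t)"

definition counting_process :: "'a measure \<Rightarrow> real \<Rightarrow> (real \<Rightarrow> 'a \<Rightarrow> nat) \<Rightarrow> bool" where
  "counting_process M T X \<longleftrightarrow>
     (\<forall>t\<in>{0..T}. X t \<in> M \<rightarrow>\<^sub>M count_space UNIV) \<and>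
     (\<forall>\<omega>\<in>space M. counting_path T (\<lambda>t. X t \<omega>))"

definition natural_filtration ::
    "'a set \<Rightarrow> 'i set \<Rightarrow> (real \<Rightarrow> 'i \<Rightarrow> 'a \<Rightarrow> nat) \<Rightarrow> real \<Rightarrow> 'a measure" where
  "natural_filtration \<Omega> I N t =
     sigma \<Omega> {N s i -` B \<inter> \<Omega> | s i B. s \<in> {0..t} \<and> i \<in> I}"

(* Given by point masses because poisson_pmf is specified only for positive rates, whereas
   parameter 0 (a point mass at 0, as 0 ^ 0 = 1) must be allowed: it occurs for s = t below. *)
definition poisson_distributed :: "'a measure \<Rightarrow> ('a \<Rightarrow> nat) \<Rightarrow> real \<Rightarrow> bool" where
  "poisson_distributed P Y m \<longleftrightarrow>
     Y \<in> P \<rightarrow>\<^sub>M count_space UNIV \<and>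
     (\<forall>n. measure P {\<omega> \<in> space P. Y \<omega> = n} = m ^ n / fact n * exp (- m))"

definition poisson_process ::
    "'a measure \<Rightarrow> (real \<Rightarrow> 'a measure) \<Rightarrow> real \<Rightarrow> (real \<Rightarrow> real) \<Rightarrow> (real \<Rightarrow> 'a \<Rightarrow> nat) \<Rightarrow> bool"
  where
  "poisson_process P F T l X \<longleftrightarrow>
     prob_space P \<and>
     filtration (space P) F \<and>
     (\<forall>t\<in>{0..T}. subalgebra P (F t)) \<and>
     counting_process P T X \<and>
     (\<forall>t\<in>{0..T}. X t \<in> F t \<rightarrow>\<^sub>M count_space UNIV) \<and>
     (\<forall>t\<in>{0..T}. 0 \<le> l t) \<and>
     set_integrable lborel {0..T} l \<and>
     (\<forall>s t. 0 \<le> s \<and> s \<le> t \<and> t \<le> T \<longrightarrow>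
        prob_space.indep_set P (sets (F s))
          (sets (vimage_algebra (space P) (\<lambda>\<omega>. X t \<omega> - X s \<omega>) (count_space UNIV))) \<and>
        poisson_distributed P (\<lambda>\<omega>. X t \<omega> - X s \<omega>) (LBINT u:{s..t}. l u))"

(* Mutual independence of whole processes over [0,T], as random elements of the product
   space of paths. *)
definition indep_processes ::
    "'a measure \<Rightarrow> real \<Rightarrow> 'i set \<Rightarrow> (real \<Rightarrow> 'i \<Rightarrow> 'a \<Rightarrow> nat) \<Rightarrow> bool" where
  "indep_processes P T I N \<longleftrightarrow>
     prob_space.indep_vars P (\<lambda>_. PiM {0..T} (\<lambda>_. count_space UNIV))
       (\<lambda>i \<omega>. \<lambda>t\<in>{0..T}. N t i \<omega>) I"

definition sensor_likelihood ::
    "real \<Rightarrow> (real \<Rightarrow> real) \<Rightarrow> (real \<Rightarrow> real) \<Rightarrow> (real \<Rightarrow> nat) \<Rightarrow> real" where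
  "sensor_likelihood T \<beta> \<nu> x =
     exp (- (LBINT s:{0..T}. \<nu> s)) *
     (\<Prod>n=1..x T. 1 + \<nu> (jump_time T x n) / \<beta> (jump_time T x n))"

definition fused_likelihood ::
    "nat \<Rightarrow> real \<Rightarrow> (nat \<Rightarrow> real \<Rightarrow> real) \<Rightarrow> (nat \<Rightarrow> real \<Rightarrow> real) \<Rightarrow>
     (real \<Rightarrow> nat \<Rightarrow> 'a \<Rightarrow> nat) \<Rightarrow> 'a \<Rightarrow> real" where
  "fused_likelihood k T \<beta> \<nu> N \<omega> =
     (\<Prod>i=1..k. sensor_likelihood T (\<beta> i) (\<nu> i) (\<lambda>t. N t i \<omega>))"

end

theory Submission
  imports Defs
begin

text \<open>
  On the \<sigma>-algebra generated by the observations, \<open>P0\<close> has density \<open>1 / L\<close> with respect to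
  \<open>P1\<close>, where \<open>L\<close> is the fused likelihood. Once this is known
  (\<open>inverse_likelihood_is_density\<close>), optimality of \<open>{L \<ge> \<gamma>}\<close> is the Neyman--Pearson argument: the
  function \<open>(1\<^bsub>L \<ge> \<gamma>\<^esub> - 1\<^bsub>A\<^esub>) (1 - \<gamma> / L)\<close> is nonnegative, and integrating it against \<open>P1\<close> compares
  the detection probabilities with \<open>\<gamma>\<close> times the false alarm probabilities.

  The density is found by discretising time rather than by stochastic calculus or by conditioning on
  the number of jumps. Cut \<open>[0,T]\<close> into \<open>2\<^sup>n\<close> equal cells. Under either hypothesis the increments of
  all sensors over the cells are independent Poisson variables, so their joint law is an explicit
  product of point masses, and on the \<sigma>-algebra of these increments the density is the quotient of two
  such products (\<open>grid_likelihood_is_density\<close>). A cell contributes to this quotient a deterministic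
  exponential, and for each jump in it the ratio of the integrals of \<open>\<beta> + \<nu>\<close> and \<open>\<beta>\<close> over the cell.
  As the grid is refined the cell around a jump time \<open>\<tau>\<close> shrinks to \<open>\<tau>\<close>, and by continuity
  the ratio tends to \<open>1 + \<nu> \<tau> / \<beta> \<tau>\<close>; hence the discrete likelihoods converge to \<open>L\<close> on every
  path (\<open>fused_grid_likelihood_tendsto\<close>).

  To pass to the limit under the integral, it pays to work with the density of \<open>P0\<close> with respect to
  \<open>P1\<close> and not the other way round. Since \<open>\<nu> \<ge> 0\<close>, every ratio is at least \<open>1\<close>, so the inverse
  likelihoods are bounded by a constant and dominated convergence applies at once, whereas the
  likelihoods themselves are only dominated by an exponential of the number of jumps. This yields the
  density on every grid \<sigma>-algebra. These form an increasing sequence, and since paths are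
  right-continuous they generate all observations, so a \<pi>-\<lambda> argument finishes the proof
  (\<open>density_on_generated_algebra\<close>). The convergence also shows that \<open>L\<close> is measurable, without any
  discussion of the measurability of jump times.
\<close>

section \<open>Jump times of a counting path\<close>

text \<open>
  The \<open>n\<close>-th jump time is the infimum of the times at which the path has reached level \<open>n\<close>:
  right-continuity puts the infimum into this set, and because steps have size one the path has
  exactly the value \<open>n\<close> there, so that level \<open>n + 1\<close> is reached strictly later. The induction needs
  the value \<open>n\<close> at the jump time along with the equivalence.
\<close>

lemma jump_time_le_iff:
  assumes x: "counting_path T x" and "T \<ge> 0" "n \<le> x T"
  shows "jump_time T x n \<in> {0..T} \<and> x (jump_time T x n) = n \<and>
    (\<forall>t\<in>{0..T}. jump_time T x n \<le> t \<longleftrightarrow> n \<le> x t)"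
  using \<open>n \<le> x T\<close>
proof (induction n)
  case 0
  then show ?case using x \<open>T \<ge> 0\<close> by (auto simp: counting_path_def)
next
  case (Suc n)
  define \<tau> where "\<tau> = jump_time T x n"
  \<comment> \<open>\<open>s\<close> will turn out to be the next jump time.\<close>
  define D where "D = {t\<in>{0..T}. Suc n \<le> x t}"
  define s where "s = Inf D"
  have \<tau>: "\<tau> \<in> {0..T}" "x \<tau> = n" "\<And>t. t \<in> {0..T} \<Longrightarrow> \<tau> \<le> t \<longleftrightarrow> n \<le> x t"
    using Suc unfolding \<tau>_def by auto
  have mono: "x a \<le> x b" if "0 \<le> a" "a \<le> b" "b \<le> T" for a b
    using x that by (auto simp: counting_path_def mono_on_def)
  have "T \<in> D" using Suc.prems \<open>T \<ge> 0\<close> by (auto simp: D_def)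
  have bdd: "bdd_below D" by (auto simp: D_def bdd_below_def intro!: exI[of _ 0])
  have s01: "0 \<le> s" "s \<le> T"
    unfolding s_def using bdd \<open>T \<in> D\<close> by (auto intro!: cInf_greatest cInf_lower simp: D_def)
  have below: "x t \<le> n" if "0 \<le> t" "t < s" for t
    using cInf_lower[OF _ bdd, of t] that s01 unfolding s_def[symmetric]
    by (force simp: D_def not_le)
  have s_in: "Suc n \<le> x s"
  proof (cases "s = T")
    case True
    then show ?thesis using Suc.prems by simp
  next
    case False
    with s01 have "s \<in> {0..<T}" by auto
    with x have "continuous (at_right s) x" by (auto simp: counting_path_def)
    then have "(x \<longlongrightarrow> x s) (at_right s)" by (simp add: continuous_within)
    then have "\<forall>\<^sub>F t in at_right s. x t = x s"
      by (simp add: tendsto_discrete)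
    then obtain b where b: "b > s" "\<And>t. s < t \<Longrightarrow> t < b \<Longrightarrow> x t = x s"
      by (auto simp: eventually_at_right_field)
    have "Inf D < b" using b s_def by simp
    then obtain d where "d \<in> D" "d < b" using cInf_lessD[of D b] \<open>T \<in> D\<close> by auto
    moreover have "s \<le> d" unfolding s_def using \<open>d \<in> D\<close> bdd by (rule cInf_lower)
    ultimately show ?thesis using b(2)[of d] by (cases "d = s") (auto simp: D_def)
  qed
  have "x 0 = 0" using x by (simp add: counting_path_def)
  then have "s > 0" using s_in s01 by (cases "s = 0") auto
  have ev: "\<forall>\<^sub>F t in at_left s. 0 \<le> t \<and> t < s"
    using \<open>s > 0\<close> by (auto simp: eventually_at_left_field intro!: exI[of _ 0])
  have inc: "increases_at x s"
    unfolding increases_at_def using ev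
    by eventually_elim (use below s_in in fastforce)
  with x \<open>s > 0\<close> s01 have "\<forall>\<^sub>F t in at_left s. x s = x t + 1"
    by (auto simp: counting_path_def)
  with ev have "\<forall>\<^sub>F t in at_left s. x s \<le> Suc n"
    by eventually_elim (use below in fastforce)
  then have "x s \<le> Suc n" by (simp add: trivial_limit_at_left_real)
  with s_in have xs: "x s = Suc n" by simp
  have "\<tau> < s"
    using mono[of s \<tau>] \<tau> xs s01 by (cases "\<tau> < s") auto
  have "(LEAST t. t \<in> {\<tau><..T} \<and> increases_at x t) = s"
  proof (rule Least_equality)
    show "s \<in> {\<tau><..T} \<and> increases_at x s" using \<open>\<tau> < s\<close> s01 inc by auto
  next
    fix t assume t: "t \<in> {\<tau><..T} \<and> increases_at x t"
    show "s \<le> t"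
    proof (rule ccontr)
      assume "\<not> s \<le> t"
      then have "x t \<le> n" using below[of t] t \<tau> by auto
      have "\<forall>\<^sub>F u in at_left t. \<tau> < u \<and> u < t"
        using t by (auto simp: eventually_at_left_field)
      moreover have "\<forall>\<^sub>F u in at_left t. x u < x t"
        using t by (simp add: increases_at_def)
      ultimately have "\<forall>\<^sub>F u in at_left t. False"
      proof eventually_elim
        case (elim u)
        then have "n \<le> x u" using \<tau>(1) \<tau>(3)[of u] t by auto
        then show False using elim \<open>x t \<le> n\<close> by auto
      qed
      then show False by (simp add: trivial_limit_at_left_real)
    qed
  qed
  then have "jump_time T x (Suc n) = s" by (simp add: \<tau>_def)
  then show ?case using s01 xs s_in below mono by (force simp: not_le[symmetric])
qed

section \<open>Likelihood on a uniform grid\<close>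

definition grid :: "real \<Rightarrow> nat \<Rightarrow> nat \<Rightarrow> real" where
  "grid T m j = T * real j / real m"

lemma grid_0 [simp]: "grid T m 0 = 0"
  and grid_end: "m > 0 \<Longrightarrow> grid T m m = T"
  and grid_Suc_diff: "grid T m (Suc j) = grid T m j + T / m"
  by (auto simp: grid_def add_divide_distrib algebra_simps)

lemma grid_mono: "T \<ge> 0 \<Longrightarrow> i \<le> j \<Longrightarrow> grid T m i \<le> grid T m j"
  by (auto simp: grid_def intro!: divide_right_mono mult_left_mono)

lemma grid_nonneg: "T \<ge> 0 \<Longrightarrow> 0 \<le> grid T m j"
  by (simp add: grid_def)

lemma grid_le: "T \<ge> 0 \<Longrightarrow> m > 0 \<Longrightarrow> j \<le> m \<Longrightarrow> grid T m j \<le> T"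
  using grid_mono[of T j m m] by (simp add: grid_end)

lemma grid_refine:
  assumes "a \<le> b"
  shows "grid T (2 ^ a) j = grid T (2 ^ b) (j * 2 ^ (b - a))"
proof -
  obtain d where "b = a + d" using assms le_Suc_ex by blast
  then show ?thesis by (simp add: grid_def power_add)
qed

text \<open>
  The index \<open>j\<close> of the half-open cell from \<open>grid T m j\<close> (excluded) to \<open>grid T m (Suc j)\<close> (included)
  that contains \<open>\<tau>\<close>. Cells are closed on the right because paths are right-continuous: a jump at
  a grid point belongs to the increment that ends there.
\<close>

definition cell :: "real \<Rightarrow> nat \<Rightarrow> real \<Rightarrow> nat" where
  "cell T m \<tau> = nat \<lceil>\<tau> * m / T\<rceil> - 1"

lemma cell_eqI:
  assumes "T > 0" "m > 0" "grid T m j < \<tau>" "\<tau> \<le> grid T m (Suc j)"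
  shows "cell T m \<tau> = j"
proof -
  have "real j < \<tau> * m / T" "\<tau> * m / T \<le> real j + 1"
    using assms by (simp_all add: grid_def field_simps)
  then have "\<lceil>\<tau> * m / T\<rceil> = int j + 1" by (intro ceiling_unique) auto
  then show ?thesis by (simp add: cell_def nat_add_distrib)
qed

lemma cell_bounds:
  assumes "T > 0" "m > 0" "0 < \<tau>" "\<tau> \<le> T"
  shows "grid T m (cell T m \<tau>) < \<tau>" "\<tau> \<le> grid T m (Suc (cell T m \<tau>))" "cell T m \<tau> < m"
proof -
  define y where "y = \<tau> * m / T"
  have y: "0 < y" "y \<le> m" using assms by (auto simp: y_def field_simps)
  have "0 < \<lceil>y\<rceil>" using y by simp
  then obtain j where j: "\<lceil>y\<rceil> = int j + 1"
    using that[of "nat (\<lceil>y\<rceil> - 1)"] by simp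
  then have c: "cell T m \<tau> = j" by (simp add: cell_def y_def[symmetric] nat_add_distrib)
  have "real j < y" "y \<le> real j + 1" using j by linarith+
  moreover have "\<lceil>y\<rceil> \<le> int m" using y by (simp add: ceiling_le_iff)
  ultimately show "grid T m (cell T m \<tau>) < \<tau>" "\<tau> \<le> grid T m (Suc (cell T m \<tau>))" "cell T m \<tau> < m"
    using assms j unfolding c by (auto simp: grid_def y_def field_simps)
qed

text \<open>
  An increment counts the levels that are reached within its cell, so distributing the factors of a
  cell over these levels turns a product over cells into a product over jumps. The number of factors
  of the latter does not grow with the grid, which is what makes the limit accessible.
\<close>

lemma prod_cells_eq_prod_jumps:
  fixes r :: "nat \<Rightarrow> real"
  assumes x: "counting_path T x" and "T > 0" "m > 0"
  shows "(\<Prod>j<m. r j ^ (x (grid T m (Suc j)) - x (grid T m j))) =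
    (\<Prod>n=1..x T. r (cell T m (jump_time T x n)))"
proof -
  let ?g = "grid T m" and ?c = "\<lambda>n. cell T m (jump_time T x n)"
  have gT: "?g p \<in> {0..T}" if "p \<le> m" for p
    using grid_nonneg[of T m p] grid_le[of T m p] that assms by auto
  have mono: "x a \<le> x b" if "0 \<le> a" "a \<le> b" "b \<le> T" for a b
    using x that by (auto simp: counting_path_def mono_on_def)
  have "(\<Prod>j<p. r j ^ (x (?g (Suc j)) - x (?g j))) = (\<Prod>n=1..x (?g p). r (?c n))"
    if "p \<le> m" for p
    using that
  proof (induction p)
    case 0
    then show ?case using x by (simp add: counting_path_def)
  next
    case (Suc p)
    have le: "x (?g p) \<le> x (?g (Suc p))"
      using Suc.prems gT[of p] gT[of "Suc p"] grid_mono[of T p "Suc p" m] assms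
      by (intro mono) auto
    have c: "?c n = p" if n: "n \<in> {x (?g p)<..x (?g (Suc p))}" for n
    proof (rule cell_eqI)
      have "x (?g (Suc p)) \<le> x T"
        using Suc.prems gT[of "Suc p"] by (intro mono) auto
      then have "n \<le> x T" using n by auto
      from jump_time_le_iff[OF x _ this] assms
      have "\<And>t. t \<in> {0..T} \<Longrightarrow> jump_time T x n \<le> t \<longleftrightarrow> n \<le> x t" by auto
      from this[of "?g p"] this[of "?g (Suc p)"]
      show "?g p < jump_time T x n" "jump_time T x n \<le> ?g (Suc p)"
        using n Suc.prems gT[of p] gT[of "Suc p"] by auto
    qed (use assms in auto)
    have "{1..x (?g (Suc p))} = {1..x (?g p)} \<union> {x (?g p)<..x (?g (Suc p))}"
      using le by auto
    then have "(\<Prod>n=1..x (?g (Suc p)). r (?c n)) =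
        (\<Prod>n=1..x (?g p). r (?c n)) * (\<Prod>n\<in>{x (?g p)<..x (?g (Suc p))}. r (?c n))"
      by (simp add: prod.union_disjoint disjoint_iff)
    also have "(\<Prod>n\<in>{x (?g p)<..x (?g (Suc p))}. r (?c n)) = r p ^ (x (?g (Suc p)) - x (?g p))"
      using c by simp
    finally show ?case using Suc by simp
  qed
  from this[of m] show ?thesis using assms by (simp add: grid_end)
qed

text \<open>
  The ratio of the two Poisson parameters that the hypotheses assign to a cell.
\<close>

definition cell_ratio :: "real \<Rightarrow> nat \<Rightarrow> (real \<Rightarrow> real) \<Rightarrow> (real \<Rightarrow> real) \<Rightarrow> nat \<Rightarrow> real" where
  "cell_ratio T m \<beta> \<nu> j =
     1 + (LBINT s:{grid T m j..grid T m (Suc j)}. \<nu> s) / (LBINT s:{grid T m j..grid T m (Suc j)}. \<beta> s)"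

lemma integral_Icc_pos:
  fixes f :: "real \<Rightarrow> real"
  assumes "a < b" "continuous_on {a..b} f" "\<And>s. s \<in> {a..b} \<Longrightarrow> 0 < f s"
  shows "0 < (LBINT s:{a..b}. f s)"
proof -
  obtain c where c: "c \<in> {a..b}" "\<And>s. s \<in> {a..b} \<Longrightarrow> f c \<le> f s"
    using continuous_attains_inf[of "{a..b}" f] assms by auto
  have "0 < (b - a) * f c" using c assms by simp
  also have "\<dots> = (LBINT s:{a..b}. f c)" using assms by (simp add: set_integral_const)
  also have "\<dots> \<le> (LBINT s:{a..b}. f s)"
    using assms c by (intro set_integral_mono borel_integrable_atLeastAtMost') auto
  finally show ?thesis .
qed

text \<open>
  Near \<open>\<tau>\<close> the quotient \<open>\<nu> / \<beta>\<close> lies within \<open>e/2\<close> of its value \<open>\<rho>\<close> at \<open>\<tau>\<close>. Multiplying by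
  \<open>\<beta> > 0\<close> and integrating keeps these bounds for the quotient of the integrals.
\<close>

lemma ratio_of_integrals_tendsto:
  fixes \<beta> \<nu> :: "real \<Rightarrow> real"
  assumes cont: "continuous_on {0..T} \<beta>" "continuous_on {0..T} \<nu>"
    and pos: "\<And>s. s \<in> {0..T} \<Longrightarrow> 0 < \<beta> s"
    and \<tau>: "\<tau> \<in> {0..T}"
    and ab: "\<forall>\<^sub>F m in F. 0 \<le> a m \<and> a m < b m \<and> b m \<le> T"
    and lim: "(a \<longlongrightarrow> \<tau>) F" "(b \<longlongrightarrow> \<tau>) F"
  shows "((\<lambda>m. (LBINT s:{a m..b m}. \<nu> s) / (LBINT s:{a m..b m}. \<beta> s)) \<longlongrightarrow> \<nu> \<tau> / \<beta> \<tau>) F"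
proof (rule tendstoI)
  fix e :: real assume "e > 0"
  define \<rho> where "\<rho> = \<nu> \<tau> / \<beta> \<tau>"
  have "continuous_on {0..T} (\<lambda>s. \<nu> s / \<beta> s)"
    using cont pos by (intro continuous_on_divide) force+
  then obtain d where d: "d > 0"
      "\<And>s. s \<in> {0..T} \<Longrightarrow> dist s \<tau> < d \<Longrightarrow> dist (\<nu> s / \<beta> s) \<rho> < e/2"
    unfolding continuous_on_iff \<rho>_def using \<tau> \<open>e > 0\<close> by (meson half_gt_zero)
  from ab tendstoD[OF lim(1) d(1)] tendstoD[OF lim(2) d(1)]
  show "\<forall>\<^sub>F m in F. dist ((LBINT s:{a m..b m}. \<nu> s) / (LBINT s:{a m..b m}. \<beta> s)) (\<nu> \<tau> / \<beta> \<tau>) < e"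
  proof eventually_elim
    case (elim m)
    let ?I = "{a m..b m}"
    have sub: "?I \<subseteq> {0..T}" using elim by auto
    have cont': "continuous_on ?I \<beta>" "continuous_on ?I \<nu>"
      using cont sub by (auto intro: continuous_on_subset)
    note int = cont'[THEN borel_integrable_atLeastAtMost']
    have B: "0 < (LBINT s:?I. \<beta> s)"
      using elim sub pos cont' by (intro integral_Icc_pos) auto
    have bnd: "(\<rho> - e/2) * \<beta> s \<le> \<nu> s" "\<nu> s \<le> (\<rho> + e/2) * \<beta> s" if s: "s \<in> ?I" for s
    proof -
      have "dist (\<nu> s / \<beta> s) \<rho> < e/2"
        using elim s sub by (intro d) (auto simp: dist_real_def abs_less_iff)
      then have "\<rho> - e/2 \<le> \<nu> s / \<beta> s" "\<nu> s / \<beta> s \<le> \<rho> + e/2"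
        unfolding dist_real_def by linarith+
      moreover have "0 < \<beta> s" using s sub pos by auto
      ultimately show "(\<rho> - e/2) * \<beta> s \<le> \<nu> s" "\<nu> s \<le> (\<rho> + e/2) * \<beta> s"
        by (simp_all add: pos_le_divide_eq pos_divide_le_eq)
    qed
    have "(\<rho> - e/2) * (LBINT s:?I. \<beta> s) \<le> (LBINT s:?I. \<nu> s)"
      "(LBINT s:?I. \<nu> s) \<le> (\<rho> + e/2) * (LBINT s:?I. \<beta> s)"
      unfolding set_integral_mult_right[symmetric]
      using bnd by (intro set_integral_mono set_integrable_mult_right int; simp)+
    then have "\<rho> - e/2 \<le> (LBINT s:?I. \<nu> s) / (LBINT s:?I. \<beta> s)"
      "(LBINT s:?I. \<nu> s) / (LBINT s:?I. \<beta> s) \<le> \<rho> + e/2"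
      using B by (simp_all add: pos_le_divide_eq pos_divide_le_eq)
    then have "\<bar>(LBINT s:?I. \<nu> s) / (LBINT s:?I. \<beta> s) - \<rho>\<bar> \<le> e/2"
      by linarith
    then show ?case using \<open>e > 0\<close> by (simp add: dist_real_def \<rho>_def)
  qed
qed

text \<open>
  The quotient of the joint Poisson masses of the increments \<open>v\<close> under the two hypotheses: the
  factorials cancel, and the exponentials of all cells combine to a single one.
\<close>

definition grid_likelihood ::
    "real \<Rightarrow> nat \<Rightarrow> (real \<Rightarrow> real) \<Rightarrow> (real \<Rightarrow> real) \<Rightarrow> (nat \<Rightarrow> nat) \<Rightarrow> real" where
  "grid_likelihood T m \<beta> \<nu> v = exp (- (LBINT s:{0..T}. \<nu> s)) * (\<Prod>j<m. cell_ratio T m \<beta> \<nu> j ^ v j)"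

lemma grid_likelihood_tendsto:
  assumes x: "counting_path T x" and "T > 0"
    and cont: "continuous_on {0..T} \<beta>" "continuous_on {0..T} \<nu>"
    and pos: "\<And>s. s \<in> {0..T} \<Longrightarrow> 0 < \<beta> s"
  shows "(\<lambda>m. grid_likelihood T m \<beta> \<nu> (\<lambda>j. x (grid T m (Suc j)) - x (grid T m j)))
    \<longlonglongrightarrow> sensor_likelihood T \<beta> \<nu> x"
proof -
  have lim: "(\<lambda>m. cell_ratio T m \<beta> \<nu> (cell T m \<tau>)) \<longlonglongrightarrow> 1 + \<nu> \<tau> / \<beta> \<tau>"
    if \<tau>: "0 < \<tau>" "\<tau> \<le> T" for \<tau>
  proof -
    let ?c = "\<lambda>m. cell T m \<tau>"
    have Tm: "(\<lambda>m. T / real m) \<longlonglongrightarrow> 0" by (rule lim_const_over_n)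
    have b: "\<forall>\<^sub>F m in sequentially. grid T m (?c m) < \<tau> \<and> \<tau> \<le> grid T m (Suc (?c m)) \<and> ?c m < m"
      using eventually_gt_at_top[of 0] by eventually_elim (auto simp: cell_bounds \<tau> \<open>T > 0\<close>)
    \<comment> \<open>The cell around \<open>\<tau>\<close> has length \<open>T / m\<close>, so both its end points tend to \<open>\<tau>\<close>.\<close>
    have la: "(\<lambda>m. grid T m (?c m)) \<longlonglongrightarrow> \<tau>"
    proof (rule tendsto_sandwich)
      show "(\<lambda>m. \<tau> - T / real m) \<longlonglongrightarrow> \<tau>" using tendsto_diff[OF tendsto_const Tm, of \<tau>] by simp
      show "\<forall>\<^sub>F m in sequentially. \<tau> - T / real m \<le> grid T m (?c m)"
        using b by eventually_elim (auto simp: grid_Suc_diff)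
      show "\<forall>\<^sub>F m in sequentially. grid T m (?c m) \<le> \<tau>"
        using b by eventually_elim auto
    qed auto
    have lb: "(\<lambda>m. grid T m (Suc (?c m))) \<longlonglongrightarrow> \<tau>"
      unfolding grid_Suc_diff using tendsto_add[OF la Tm] by simp
    have ev: "\<forall>\<^sub>F m in sequentially. 0 \<le> grid T m (?c m) \<and>
        grid T m (?c m) < grid T m (Suc (?c m)) \<and> grid T m (Suc (?c m)) \<le> T"
      using b
      by eventually_elim (use \<open>T > 0\<close> grid_nonneg[of T] grid_le[of T] in \<open>simp add: Suc_le_eq\<close>)
    show ?thesis
      unfolding cell_ratio_def using \<tau> pos
      by (intro tendsto_add tendsto_const ratio_of_integrals_tendsto[OF cont _ _ ev la lb]) auto
  qed
  have "(\<lambda>m. exp (- (LBINT s:{0..T}. \<nu> s)) *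
      (\<Prod>n=1..x T. cell_ratio T m \<beta> \<nu> (cell T m (jump_time T x n))))
    \<longlonglongrightarrow> sensor_likelihood T \<beta> \<nu> x"
    unfolding sensor_likelihood_def
  proof (intro tendsto_mult tendsto_const tendsto_prod lim)
    fix n assume n: "n \<in> {1..x T}"
    then have "jump_time T x n \<in> {0..T}" "x (jump_time T x n) = n"
      using jump_time_le_iff[OF x, of n] \<open>T > 0\<close> by auto
    moreover have "x 0 = 0" using x by (simp add: counting_path_def)
    ultimately show "0 < jump_time T x n" "jump_time T x n \<le> T"
      using n by (cases "jump_time T x n = 0"; simp)+
  qed
  moreover have "\<forall>\<^sub>F m in sequentially. exp (- (LBINT s:{0..T}. \<nu> s)) *
      (\<Prod>n=1..x T. cell_ratio T m \<beta> \<nu> (cell T m (jump_time T x n))) =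
      grid_likelihood T m \<beta> \<nu> (\<lambda>j. x (grid T m (Suc j)) - x (grid T m j))"
    using eventually_gt_at_top[of 0]
    by eventually_elim
      (simp add: grid_likelihood_def prod_cells_eq_prod_jumps[OF x \<open>T > 0\<close>])
  ultimately show ?thesis by (rule Lim_transform_eventually)
qed

text \<open>
  The right end of the cell around \<open>t\<close> tends to \<open>t\<close> and is never smaller than \<open>t\<close>, so by
  right-continuity the path there is eventually equal to the path at \<open>t\<close>. This is how the
  grid observations determine all others.
\<close>

lemma counting_path_on_fine_grid:
  assumes x: "counting_path T x" and "0 < t" "t \<le> T"
  shows "\<forall>\<^sub>F m in sequentially. x (grid T m (Suc (cell T m t))) = x t"
proof -
  have pos: "\<forall>\<^sub>F m in sequentially. (0::nat) < m" by (rule eventually_gt_at_top)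
  have "\<exists>b>t. \<forall>s. t \<le> s \<longrightarrow> s \<le> T \<longrightarrow> s < b \<longrightarrow> x s = x t"
  proof (cases "t = T")
    case True
    then show ?thesis by (intro exI[of _ "T + 1"]) auto
  next
    case False
    with x assms have "(x \<longlongrightarrow> x t) (at_right t)"
      by (auto simp: counting_path_def continuous_within)
    then have "\<forall>\<^sub>F s in at_right t. x s = x t" by (simp add: tendsto_discrete)
    then obtain b where "b > t" "\<And>s. t < s \<Longrightarrow> s < b \<Longrightarrow> x s = x t"
      by (auto simp: eventually_at_right_field)
    then show ?thesis by (metis less_eq_real_def)
  qed
  then obtain b where b: "b > t" "\<And>s. t \<le> s \<Longrightarrow> s \<le> T \<Longrightarrow> s < b \<Longrightarrow> x s = x t" by blast
  have "(\<lambda>m. T / real m) \<longlonglongrightarrow> 0" by (rule lim_const_over_n)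
  then have "\<forall>\<^sub>F m in sequentially. T / real m < b - t"
    using b(1) by (intro order_tendstoD(2)[where a = "b - t"]) auto
  with pos show ?thesis
  proof eventually_elim
    case (elim m)
    note c = cell_bounds[of T m t]
    have "grid T m (Suc (cell T m t)) < b" using c elim assms by (simp add: grid_Suc_diff)
    moreover have "grid T m (Suc (cell T m t)) \<le> T" using c elim assms by (intro grid_le) auto
    ultimately show ?case using c elim assms by (intro b) auto
  qed
qed

lemma sum_integrals_over_grid:
  fixes f :: "real \<Rightarrow> real"
  assumes "T \<ge> 0" "m > 0" "continuous_on {0..T} f"
  shows "(\<Sum>j<m. LBINT s:{grid T m j..grid T m (Suc j)}. f s) = (LBINT s:{0..T}. f s)"
proof -
  have LB: "(LBINT s:{a..b}. f s) = integral {a..b} f" "f integrable_on {a..b}"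
    if "0 \<le> a" "b \<le> T" for a b
  proof -
    have "set_integrable lborel {a..b} f"
      using assms(3) that by (intro borel_integrable_atLeastAtMost') (auto intro: continuous_on_subset)
    then show "(LBINT s:{a..b}. f s) = integral {a..b} f" "f integrable_on {a..b}"
      by (auto dest: set_borel_integral_eq_integral)
  qed
  have "(\<Sum>j<p. LBINT s:{grid T m j..grid T m (Suc j)}. f s) = (LBINT s:{0..grid T m p}. f s)"
    if "p \<le> m" for p
    using that
  proof (induction p)
    case 0
    then show ?case using LB[of 0 0] assms by simp
  next
    case (Suc p)
    have "integral {0..grid T m p} f + integral {grid T m p..grid T m (Suc p)} f
        = integral {0..grid T m (Suc p)} f"
      using Suc.prems assms grid_nonneg[of T m p] grid_mono[of T p "Suc p" m] grid_le[of T m "Suc p"]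
      by (intro Henstock_Kurzweil_Integration.integral_combine LB) auto
    then show ?case
      using Suc assms grid_nonneg[of T m] grid_le[of T m "Suc p"] grid_le[of T m p] by (simp add: LB)
  qed
  from this[of m] show ?thesis using assms by (simp add: grid_end)
qed

section \<open>Independent Poisson increments\<close>

definition poisson_mass :: "real \<Rightarrow> nat \<Rightarrow> real" where
  "poisson_mass m n = m ^ n / fact n * exp (- m)"

text \<open>
  Peel off the last increment: the event about the earlier ones belongs to the filtration at the time
  when the last increment starts, and is therefore independent of it.
\<close>

lemma poisson_process_increments:
  fixes t :: "nat \<Rightarrow> real"
  assumes pp: "poisson_process P F T l X"
    and t: "\<And>j. j \<le> m \<Longrightarrow> t j \<in> {0..T}" "\<And>j. j < m \<Longrightarrow> t j \<le> t (Suc j)"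
  shows "measure P {\<omega>\<in>space P. \<forall>j<m. X (t (Suc j)) \<omega> - X (t j) \<omega> = v j} =
    (\<Prod>j<m. poisson_mass (LBINT u:{t j..t (Suc j)}. l u) (v j))"
proof -
  interpret P: prob_space P using pp by (simp add: poisson_process_def)
  interpret F: filtration "space P" F using pp by (simp add: poisson_process_def)
  have adapted: "X s \<in> F u \<rightarrow>\<^sub>M count_space UNIV" if "0 \<le> s" "s \<le> u" "u \<le> T" for s u
  proof -
    have "X s \<in> F s \<rightarrow>\<^sub>M count_space UNIV" using pp that by (simp add: poisson_process_def)
    then show ?thesis
      using F.sets_F_mono[OF \<open>s \<le> u\<close>] by (auto simp: measurable_def F.space_F)
  qed
  define E where "E p = {\<omega>\<in>space P. \<forall>j<p. X (t (Suc j)) \<omega> - X (t j) \<omega> = v j}" for p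
  have tm: "t i \<le> t j" if "i \<le> j" "j \<le> m" for i j
    using that
  proof (induction j rule: dec_induct)
    case (step j)
    then show ?case using t(2)[of j] by simp
  qed simp
  have "E p \<in> sets (F (t p)) \<and>
      measure P (E p) = (\<Prod>j<p. poisson_mass (LBINT u:{t j..t (Suc j)}. l u) (v j))"
    if "p \<le> m" for p
    using that
  proof (induction p)
    case 0
    then show ?case using sets.top[of "F (t 0)"] by (simp add: E_def F.space_F P.prob_space)
  next
    case (Suc p)
    let ?Y = "\<lambda>\<omega>. X (t (Suc p)) \<omega> - X (t p) \<omega>"
    define D where "D = {\<omega>\<in>space P. ?Y \<omega> = v p}"
    have tp: "0 \<le> t p" "t p \<le> t (Suc p)" "t (Suc p) \<le> T"
      using t(1)[of p] t(1)[of "Suc p"] t(2)[of p] Suc.prems by auto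
    have E_Suc: "E (Suc p) = E p \<inter> D"
      by (auto simp: E_def D_def less_Suc_eq)
    have "D \<in> sets (vimage_algebra (space P) ?Y (count_space UNIV))"
      using in_vimage_algebra[of "{v p}" "count_space UNIV" ?Y "space P"]
      by (simp add: D_def vimage_def Collect_conj_eq Int_commute)
    moreover have "P.indep_set (sets (F (t p)))
        (sets (vimage_algebra (space P) ?Y (count_space UNIV)))"
      and Y: "poisson_distributed P ?Y (LBINT u:{t p..t (Suc p)}. l u)"
      using pp tp by (auto simp: poisson_process_def)
    ultimately have "measure P (E p \<inter> D) = measure P (E p) * measure P D"
      using Suc by (intro P.indep_setD) auto
    moreover have "measure P D = poisson_mass (LBINT u:{t p..t (Suc p)}. l u) (v p)"
      using Y by (simp add: poisson_distributed_def D_def poisson_mass_def)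
    moreover have "E (Suc p) \<in> sets (F (t (Suc p)))"
    proof -
      have "{\<omega>\<in>space (F (t (Suc p))). X (t (Suc j)) \<omega> - X (t j) \<omega> = v j} \<in> sets (F (t (Suc p)))"
        if "j \<in> {..<Suc p}" for j
      proof -
        have [measurable]: "X (t j) \<in> F (t (Suc p)) \<rightarrow>\<^sub>M count_space UNIV"
          "X (t (Suc j)) \<in> F (t (Suc p)) \<rightarrow>\<^sub>M count_space UNIV"
          using that Suc.prems t(1)[of j] t(1)[of "Suc j"] tm[of j "Suc p"] tm[of "Suc j" "Suc p"] tp
          by (auto intro!: adapted)
        show ?thesis by measurable
      qed
      then have "{\<omega>\<in>space (F (t (Suc p))). \<forall>j\<in>{..<Suc p}. X (t (Suc j)) \<omega> - X (t j) \<omega> = v j}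
          \<in> sets (F (t (Suc p)))"
        by (intro sets.sets_Collect_finite_All) auto
      moreover have "{\<omega>\<in>space (F (t (Suc p))). \<forall>j\<in>{..<Suc p}. X (t (Suc j)) \<omega> - X (t j) \<omega> = v j}
          = E (Suc p)"
        unfolding E_def F.space_F by blast
      ultimately show ?thesis by (simp only:)
    qed
    ultimately show ?case using Suc by (simp add: E_Suc)
  qed
  then have "measure P (E m) = (\<Prod>j<m. poisson_mass (LBINT u:{t j..t (Suc j)}. l u) (v j))"
    by blast
  then show ?thesis unfolding E_def .
qed

lemma independent_poisson_increments:
  fixes t :: "nat \<Rightarrow> real"
  assumes pp: "\<And>i. i \<in> I \<Longrightarrow> poisson_process P F T (l i) (\<lambda>t. N t i)"
    and ind: "indep_processes P T I N" and P: "prob_space P" and I: "finite I" "I \<noteq> {}"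
    and t: "\<And>j. j \<le> m \<Longrightarrow> t j \<in> {0..T}" "\<And>j. j < m \<Longrightarrow> t j \<le> t (Suc j)"
  shows "measure P {\<omega>\<in>space P. \<forall>i\<in>I. \<forall>j<m. N (t (Suc j)) i \<omega> - N (t j) i \<omega> = v i j} =
    (\<Prod>i\<in>I. \<Prod>j<m. poisson_mass (LBINT u:{t j..t (Suc j)}. l i u) (v i j))"
proof -
  interpret P: prob_space P by fact
  let ?M = "PiM {0..T} (\<lambda>_. count_space (UNIV :: nat set))"
  let ?X = "\<lambda>i \<omega>. \<lambda>t\<in>{0..T}. N t i \<omega>"
  define A where "A i = {x\<in>space ?M. \<forall>j\<in>{..<m}. x (t (Suc j)) - x (t j) = v i j}" for i
  have A: "A i \<in> sets ?M" for i
  proof -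
    have "{x\<in>space ?M. x (t (Suc j)) - x (t j) = v i j} \<in> sets ?M" if "j \<in> {..<m}" for j
    proof -
      have [measurable]: "(\<lambda>x. x (t j)) \<in> ?M \<rightarrow>\<^sub>M count_space UNIV"
        "(\<lambda>x. x (t (Suc j))) \<in> ?M \<rightarrow>\<^sub>M count_space UNIV"
        using t(1)[of j] t(1)[of "Suc j"] that by (auto intro!: measurable_component_singleton)
      show ?thesis by measurable
    qed
    then show ?thesis unfolding A_def by (intro sets.sets_Collect_finite_All) auto
  qed
  have pre: "?X i -` A i \<inter> space P = {\<omega>\<in>space P. \<forall>j<m. N (t (Suc j)) i \<omega> - N (t j) i \<omega> = v i j}" for i
    using t(1) by (auto simp: A_def space_PiM Ball_def Suc_le_eq)
  have "measure P (\<Inter>i\<in>I. ?X i -` A i \<inter> space P) = (\<Prod>i\<in>I. measure P (?X i -` A i \<inter> space P))"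
    using ind I A unfolding indep_processes_def P.indep_vars_def2
    by (intro P.indep_setsD[where F = "\<lambda>i. {?X i -` A \<inter> space P |A. A \<in> sets ?M}"]) auto
  also have "(\<Inter>i\<in>I. ?X i -` A i \<inter> space P) =
      {\<omega>\<in>space P. \<forall>i\<in>I. \<forall>j<m. N (t (Suc j)) i \<omega> - N (t j) i \<omega> = v i j}"
    unfolding pre using I by auto
  also have "(\<Prod>i\<in>I. measure P (?X i -` A i \<inter> space P)) =
      (\<Prod>i\<in>I. \<Prod>j<m. poisson_mass (LBINT u:{t j..t (Suc j)}. l i u) (v i j))"
  proof (rule prod.cong[OF refl])
    fix i assume "i \<in> I"
    then show "measure P (?X i -` A i \<inter> space P) =
        (\<Prod>j<m. poisson_mass (LBINT u:{t j..t (Suc j)}. l i u) (v i j))"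
      unfolding pre by (rule poisson_process_increments[where t = t and m = m, OF pp t])
  qed
  finally show ?thesis .
qed

section \<open>Densities on generated \<sigma>-algebras\<close>

text \<open>
  For a variable with countably many values, the law is determined by its point masses, so their
  quotient is a density on the \<sigma>-algebra generated by the variable.
\<close>

lemma countable_likelihood_ratio:
  assumes V: "V \<in> P \<rightarrow>\<^sub>M count_space C" and "countable C"
    and PQ: "sets P = sets Q"
    and eq: "\<And>v. v \<in> C \<Longrightarrow>
      emeasure P (V -` {v} \<inter> space P) = z v * emeasure Q (V -` {v} \<inter> space Q)"
    and A: "A \<in> sets (vimage_algebra (space Q) V (count_space C))"
  shows "emeasure P A = (\<integral>\<^sup>+\<omega>. z (V \<omega>) * indicator A \<omega> \<partial>Q)"
proof -
  have VQ: "V \<in> Q \<rightarrow>\<^sub>M count_space C"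
    using V PQ by (simp cong: measurable_cong_sets)
  have sp: "space P = space Q" using PQ by (rule sets_eq_imp_space_eq)
  have "distr P (count_space C) V = density (distr Q (count_space C) V) z"
  proof (rule measure_eqI_countable[OF _ _ \<open>countable C\<close>])
    fix v assume v: "v \<in> C"
    have "emeasure (density (distr Q (count_space C) V) z) {v} =
        (\<integral>\<^sup>+w. z v * indicator {v} w \<partial>distr Q (count_space C) V)"
      using v by (subst emeasure_density) (auto intro!: nn_integral_cong split: split_indicator)
    also have "\<dots> = z v * emeasure Q (V -` {v} \<inter> space Q)"
      using v VQ by (subst nn_integral_cmult_indicator) (auto simp: emeasure_distr)
    finally show "emeasure (distr P (count_space C) V) {v} =
        emeasure (density (distr Q (count_space C) V) z) {v}"
      using v V by (simp add: emeasure_distr eq)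
  qed auto
  note distr = this
  from A obtain B where B: "B \<subseteq> C" "A = V -` B \<inter> space Q"
    by (subst (asm) sets_vimage_algebra2) (use VQ in \<open>auto dest: measurable_space\<close>)
  have "emeasure P A = emeasure (distr P (count_space C) V) B"
    using B V sp by (simp add: emeasure_distr)
  also have "\<dots> = (\<integral>\<^sup>+w. z w * indicator B w \<partial>distr Q (count_space C) V)"
    unfolding distr using B by (subst emeasure_density) auto
  also have "\<dots> = (\<integral>\<^sup>+\<omega>. z (V \<omega>) * indicator B (V \<omega>) \<partial>Q)"
    using B by (subst nn_integral_distr[OF VQ]) auto
  also have "\<dots> = (\<integral>\<^sup>+\<omega>. z (V \<omega>) * indicator A \<omega> \<partial>Q)"
    using B by (intro nn_integral_cong) (auto split: split_indicator)
  finally show ?thesis .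
qed

text \<open>
  An event of some \<open>G m\<close> belongs to all later \<open>G n\<close>, so its measure is given by \<open>Z n\<close> for all
  large \<open>n\<close>, and bounded convergence replaces \<open>Z n\<close> by the limit. An increasing union of \<sigma>-algebras
  is closed under intersections, hence the two measures agree on what it generates. The bound
  \<open>c\<close> ensures that no mass is lost in the limit.
\<close>

lemma density_on_generated_algebra:
  fixes G :: "nat \<Rightarrow> 'a measure" and Z :: "nat \<Rightarrow> 'a \<Rightarrow> ennreal"
  assumes "finite_measure P" "finite_measure Q" and PQ: "sets P = sets Q"
    and G: "\<And>n. subalgebra Q (G n)" "\<And>m n. m \<le> n \<Longrightarrow> sets (G m) \<subseteq> sets (G n)"
    and dens: "\<And>n A. A \<in> sets (G n) \<Longrightarrow> emeasure P A = (\<integral>\<^sup>+\<omega>. Z n \<omega> * indicator A \<omega> \<partial>Q)"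
    and meas: "\<And>n. Z n \<in> borel_measurable Q" "Z' \<in> borel_measurable Q"
    and bound: "\<And>n \<omega>. Z n \<omega> \<le> ennreal c"
    and lim: "\<And>\<omega>. \<omega> \<in> space Q \<Longrightarrow> (\<lambda>n. Z n \<omega>) \<longlonglongrightarrow> Z' \<omega>"
    and A: "A \<in> sigma_sets (space Q) (\<Union>n. sets (G n))"
  shows "emeasure P A = (\<integral>\<^sup>+\<omega>. Z' \<omega> * indicator A \<omega> \<partial>Q)"
proof -
  interpret P: finite_measure P by fact
  interpret Q: finite_measure Q by fact
  let ?E = "\<Union>n. sets (G n)"
  have E: "?E \<subseteq> sets Q" "?E \<subseteq> Pow (space Q)"
    using G(1) sets.sets_into_space by (fastforce simp: subalgebra_def)+
  define H where "H = sigma (space Q) ?E"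
  have sH: "sets H = sigma_sets (space Q) ?E" and "space H = space Q"
    using E by (simp_all add: H_def)
  have HQ: "subalgebra Q H" and HP: "subalgebra P H" and HD: "subalgebra (density Q Z') H"
    using E \<open>space H = space Q\<close> PQ sets_eq_imp_space_eq[OF PQ]
    by (auto simp: subalgebra_def sH intro: sets.sigma_sets_subset[THEN subsetD])
  have on_E: "emeasure P B = emeasure (density Q Z') B" if "B \<in> ?E" for B
  proof -
    from that obtain m where m: "B \<in> sets (G m)" by auto
    have BQ [measurable]: "B \<in> sets Q" using that E by auto
    have "(\<lambda>n. \<integral>\<^sup>+\<omega>. Z n \<omega> * indicator B \<omega> \<partial>Q) \<longlonglongrightarrow> (\<integral>\<^sup>+\<omega>. Z' \<omega> * indicator B \<omega> \<partial>Q)"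
    proof (rule nn_integral_dominated_convergence[where w = "\<lambda>_. ennreal c"])
      show "(\<integral>\<^sup>+\<omega>. ennreal c \<partial>Q) < \<infinity>"
        by (simp add: ennreal_mult_eq_top_iff less_top[symmetric])
      show "AE \<omega> in Q. Z n \<omega> * indicator B \<omega> \<le> ennreal c" for n
        using bound by (auto split: split_indicator)
      show "AE \<omega> in Q. (\<lambda>n. Z n \<omega> * indicator B \<omega>) \<longlonglongrightarrow> Z' \<omega> * indicator B \<omega>"
        using lim by (auto split: split_indicator)
    qed (use meas in measurable)
    moreover have "\<forall>\<^sub>F n in sequentially. (\<integral>\<^sup>+\<omega>. Z n \<omega> * indicator B \<omega> \<partial>Q) = emeasure P B"
      using eventually_ge_at_top[of m]
    proof eventually_elim
      case (elim n)
      then have "B \<in> sets (G n)" using G(2) m by blast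
      then show ?case by (simp add: dens)
    qed
    ultimately have "(\<lambda>_::nat. emeasure P B) \<longlonglongrightarrow> (\<integral>\<^sup>+\<omega>. Z' \<omega> * indicator B \<omega> \<partial>Q)"
      by (rule Lim_transform_eventually)
    then show ?thesis
      using meas by (simp add: emeasure_density LIMSEQ_const_iff)
  qed
  have "restr_to_subalg P H = restr_to_subalg (density Q Z') H"
  proof (rule measure_eqI_generator_eq[where E = ?E and A = "\<lambda>_. space Q"])
    show "Int_stable ?E"
    proof (rule Int_stableI)
      fix a b assume "a \<in> ?E" "b \<in> ?E"
      then obtain m n where "a \<in> sets (G m)" "b \<in> sets (G n)" by auto
      then have "a \<in> sets (G (max m n))" "b \<in> sets (G (max m n))"
        using G(2)[of m "max m n"] G(2)[of n "max m n"] by auto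
      then show "a \<inter> b \<in> ?E" by blast
    qed
    show "emeasure (restr_to_subalg P H) B = emeasure (restr_to_subalg (density Q Z') H) B"
      if "B \<in> ?E" for B
      using that on_E[OF that] emeasure_restr_to_subalg[OF HP, of B] emeasure_restr_to_subalg[OF HD, of B]
      by (simp add: sH sigma_sets.Basic)
    show "emeasure (restr_to_subalg P H) (space Q) \<noteq> \<infinity>"
      using P.emeasure_finite emeasure_restr_to_subalg[OF HP, of "space Q"] sets.top[of H]
        \<open>space H = space Q\<close> by simp
    show "range (\<lambda>_. space Q) \<subseteq> ?E"
    proof -
      have "space Q \<in> sets (G 0)" using G(1)[of 0] by (metis sets.top subalgebra_def)
      then show ?thesis by blast
    qed
    show "sets (restr_to_subalg P H) = sigma_sets (space Q) ?E"
      "sets (restr_to_subalg (density Q Z') H) = sigma_sets (space Q) ?E"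
      using sets_restr_to_subalg[OF HP] sets_restr_to_subalg[OF HD] sH by simp_all
  qed (use E in simp_all)
  then have "emeasure P A = emeasure (density Q Z') A"
    using A emeasure_restr_to_subalg[OF HP, of A] emeasure_restr_to_subalg[OF HD, of A] by (simp add: sH)
  also have "\<dots> = (\<integral>\<^sup>+\<omega>. Z' \<omega> * indicator A \<omega> \<partial>Q)"
    using A HQ meas by (intro emeasure_density) (auto simp: subalgebra_def sH)
  finally show ?thesis .
qed

section \<open>The Neyman--Pearson argument\<close>

text \<open>
  The two factors of \<open>(1\<^bsub>L \<ge> \<gamma>\<^esub> - 1\<^bsub>A\<^esub>) (1 - \<gamma> / L)\<close> never have opposite signs. With \<open>1 / L\<close> the density
  of \<open>P\<close> with respect to \<open>Q\<close>, the integral of this product under \<open>Q\<close> is the gain in detection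
  probability minus \<open>\<gamma>\<close> times the difference of the false alarm probabilities.
\<close>

lemma neyman_pearson:
  fixes L :: "'a \<Rightarrow> real"
  assumes "prob_space P" "prob_space Q" and PQ: "sets P = sets Q"
    and L: "L \<in> borel_measurable Q" "\<And>\<omega>. \<omega> \<in> space Q \<Longrightarrow> 0 < L \<omega>" and "\<gamma> > 0"
    and A: "{\<omega>\<in>space Q. \<gamma> \<le> L \<omega>} \<in> sets F" "A \<in> sets F" "sets F \<subseteq> sets Q"
    and dens: "\<And>A. A \<in> sets F \<Longrightarrow> emeasure P A = (\<integral>\<^sup>+\<omega>. ennreal (1 / L \<omega>) * indicator A \<omega> \<partial>Q)"
    and less: "measure P A \<le> measure P {\<omega>\<in>space Q. \<gamma> \<le> L \<omega>}"
  shows "measure Q A \<le> measure Q {\<omega>\<in>space Q. \<gamma> \<le> L \<omega>}"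
proof -
  interpret P: prob_space P by fact
  interpret Q: prob_space Q by fact
  let ?S = "{\<omega>\<in>space Q. \<gamma> \<le> L \<omega>}"
  note [measurable] = L(1)
  have int: "integrable Q (\<lambda>\<omega>. 1 / L \<omega> * indicator B \<omega>)"
    "measure P B = (\<integral>\<omega>. 1 / L \<omega> * indicator B \<omega> \<partial>Q)" if "B \<in> sets F" for B
  proof -
    have [measurable]: "B \<in> sets Q" using that A by auto
    have "(\<integral>\<^sup>+\<omega>. ennreal (1 / L \<omega> * indicator B \<omega>) \<partial>Q) = emeasure P B"
      unfolding dens[OF that] by (intro nn_integral_cong) (auto split: split_indicator)
    moreover have "AE \<omega> in Q. 0 \<le> 1 / L \<omega> * indicator B \<omega>"
      using L(2) by (auto intro!: AE_I2 simp: less_imp_le)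
    ultimately show "integrable Q (\<lambda>\<omega>. 1 / L \<omega> * indicator B \<omega>)"
      "measure P B = (\<integral>\<omega>. 1 / L \<omega> * indicator B \<omega> \<partial>Q)"
      by (auto intro!: integrableI_nonneg simp: less_top[symmetric] integral_eq_nn_integral measure_def)
  qed
  have [measurable]: "A \<in> sets Q" "?S \<in> sets Q" using A by auto
  note iS = int[OF A(1)] and iA = int[OF A(2)]
  have ind: "integrable Q (indicator B :: _ \<Rightarrow> real)" if "B \<in> sets Q" for B
    using that by (simp add: Q.emeasure_finite less_top[symmetric])
  have "0 \<le> (\<integral>\<omega>. (indicator ?S \<omega> - indicator A \<omega>) -
      \<gamma> * (1 / L \<omega> * indicator ?S \<omega> - 1 / L \<omega> * indicator A \<omega>) \<partial>Q)"
  proof (rule Bochner_Integration.integral_nonneg_AE, rule AE_I2)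
    fix \<omega> assume \<omega>: "\<omega> \<in> space Q"
    then have "\<gamma> \<le> L \<omega> \<longleftrightarrow> \<gamma> / L \<omega> \<le> 1" using L(2) by (simp add: field_simps)
    then show "0 \<le> (indicator ?S \<omega> - indicator A \<omega>) -
        \<gamma> * (1 / L \<omega> * indicator ?S \<omega> - 1 / L \<omega> * indicator A \<omega>)"
      using \<omega> by (auto split: split_indicator)
  qed
  also have "\<dots> = (measure Q ?S - measure Q A) - \<gamma> * (measure P ?S - measure P A)"
    using iS iA ind by simp
  finally have "\<gamma> * (measure P ?S - measure P A) \<le> measure Q ?S - measure Q A" by simp
  moreover have "0 \<le> \<gamma> * (measure P ?S - measure P A)" using less \<open>\<gamma> > 0\<close> by simp
  ultimately show ?thesis by linarith
qed

section \<open>Poisson masses of the cells under the two hypotheses\<close>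

lemma poisson_mass_shift:
  assumes "b \<noteq> 0"
  shows "poisson_mass (b + n) v = exp (- n) * (1 + n / b) ^ v * poisson_mass b v"
proof -
  have "b + n = (1 + n / b) * b" using assms by (simp add: field_simps)
  then have "(b + n) ^ v = (1 + n / b) ^ v * b ^ v" by (simp only: power_mult_distrib)
  moreover have "exp (- (b + n)) = exp (- n) * exp (- b)" by (simp flip: exp_add)
  ultimately show ?thesis by (simp add: poisson_mass_def)
qed

lemma grid_likelihood_changes_poisson_masses:
  assumes "T > 0" "m > 0"
    and cont: "continuous_on {0..T} \<beta>" "continuous_on {0..T} \<nu>"
    and pos: "\<And>s. s \<in> {0..T} \<Longrightarrow> 0 < \<beta> s"
  shows "(\<Prod>j<m. poisson_mass (LBINT u:{grid T m j..grid T m (Suc j)}. \<beta> u + \<nu> u) (v j)) =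
    grid_likelihood T m \<beta> \<nu> v *
      (\<Prod>j<m. poisson_mass (LBINT u:{grid T m j..grid T m (Suc j)}. \<beta> u) (v j))"
proof -
  let ?I = "\<lambda>j. {grid T m j..grid T m (Suc j)}"
  have "poisson_mass (LBINT u:?I j. \<beta> u + \<nu> u) (v j) =
      exp (- (LBINT u:?I j. \<nu> u)) * cell_ratio T m \<beta> \<nu> j ^ v j * poisson_mass (LBINT u:?I j. \<beta> u) (v j)"
    if "j < m" for j
  proof -
    have sub: "?I j \<subseteq> {0..T}"
      using that assms grid_nonneg[of T m j] grid_le[of T m "Suc j"] by auto
    then have cont': "continuous_on (?I j) \<beta>" "continuous_on (?I j) \<nu>"
      using cont by (auto intro: continuous_on_subset)
    have "0 < (LBINT u:?I j. \<beta> u)"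
      using sub pos cont' assms by (intro integral_Icc_pos) (auto simp: grid_Suc_diff)
    then show ?thesis
      using cont'[THEN borel_integrable_atLeastAtMost']
      by (simp add: set_integral_add poisson_mass_shift cell_ratio_def)
  qed
  then show ?thesis
    using sum_integrals_over_grid[of T m \<nu>] assms
    by (simp add: grid_likelihood_def prod.distrib sum_negf flip: exp_sum)
qed

lemma cell_ratio_ge_1:
  assumes "\<And>s. s \<in> {0..T} \<Longrightarrow> 0 \<le> \<beta> s" "\<And>s. s \<in> {0..T} \<Longrightarrow> 0 \<le> \<nu> s" "T \<ge> 0" "j < m"
  shows "1 \<le> cell_ratio T m \<beta> \<nu> j"
proof -
  have "0 \<le> (LBINT s:{grid T m j..grid T m (Suc j)}. f s)"
    if "\<And>s. s \<in> {0..T} \<Longrightarrow> 0 \<le> f s" for f :: "real \<Rightarrow> real"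
    unfolding set_lebesgue_integral_def
    using that assms grid_nonneg[of T m j] grid_le[of T m "Suc j"]
    by (intro Bochner_Integration.integral_nonneg) (auto split: split_indicator)
  then show ?thesis using assms by (simp add: cell_ratio_def)
qed

text \<open>
  This lower bound does not depend on the grid or the path. It gives the constant that dominates the
  inverse likelihoods.
\<close>

lemma grid_likelihood_ge:
  assumes "\<And>s. s \<in> {0..T} \<Longrightarrow> 0 \<le> \<beta> s" "\<And>s. s \<in> {0..T} \<Longrightarrow> 0 \<le> \<nu> s" "T \<ge> 0"
  shows "exp (- (LBINT s:{0..T}. \<nu> s)) \<le> grid_likelihood T m \<beta> \<nu> v"
  unfolding grid_likelihood_def using cell_ratio_ge_1[of T \<beta> \<nu> _ m] assms
  by (auto intro!: prod_ge_1 one_le_power)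

lemma sensor_likelihood_pos:
  assumes x: "counting_path T x" and "T > 0"
    and "\<And>s. s \<in> {0..T} \<Longrightarrow> 0 < \<beta> s" "\<And>s. s \<in> {0..T} \<Longrightarrow> 0 \<le> \<nu> s"
  shows "0 < sensor_likelihood T \<beta> \<nu> x"
  unfolding sensor_likelihood_def
proof (intro mult_pos_pos prod_pos)
  fix n assume "n \<in> {1..x T}"
  then have "jump_time T x n \<in> {0..T}" using jump_time_le_iff[OF x, of n] \<open>T > 0\<close> by auto
  then show "0 < 1 + \<nu> (jump_time T x n) / \<beta> (jump_time T x n)"
    using assms by (intro add_pos_nonneg divide_nonneg_pos) auto
qed simp

lemma space_natural_filtration: "space (natural_filtration \<Omega> I N t) = \<Omega>"
  by (simp add: natural_filtration_def space_measure_of_conv)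

section \<open>The density of one hypothesis with respect to the other\<close>

locale poisson_hypotheses =
  fixes k :: nat and T :: real and \<beta> \<nu> :: "nat \<Rightarrow> real \<Rightarrow> real"
    and M P0 P1 :: "'a measure" and N :: "real \<Rightarrow> nat \<Rightarrow> 'a \<Rightarrow> nat"
  assumes k: "k \<ge> 1" and T: "T > 0"
    and \<beta>_cont: "i \<in> {1..k} \<Longrightarrow> continuous_on {0..T} (\<beta> i)"
    and \<nu>_cont: "i \<in> {1..k} \<Longrightarrow> continuous_on {0..T} (\<nu> i)"
    and \<beta>_pos: "i \<in> {1..k} \<Longrightarrow> s \<in> {0..T} \<Longrightarrow> 0 < \<beta> i s"
    and \<nu>_nonneg: "i \<in> {1..k} \<Longrightarrow> s \<in> {0..T} \<Longrightarrow> 0 \<le> \<nu> i s"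
    and counting: "i \<in> {1..k} \<Longrightarrow> counting_process M T (\<lambda>t. N t i)"
    and P0: "prob_space P0" and sets_P0: "sets P0 = sets M"
    and P1: "prob_space P1" and sets_P1: "sets P1 = sets M"
    and pp0: "i \<in> {1..k} \<Longrightarrow> poisson_process P0 (natural_filtration (space M) {1..k} N) T (\<beta> i) (\<lambda>t. N t i)"
    and ind0: "indep_processes P0 T {1..k} N"
    and pp1: "i \<in> {1..k} \<Longrightarrow> poisson_process P1 (natural_filtration (space M) {1..k} N) T (\<lambda>t. \<beta> i t + \<nu> i t) (\<lambda>t. N t i)"
    and ind1: "indep_processes P1 T {1..k} N"
begin

text \<open>
  The increments of all sensors over the cells of the dyadic grid, as an extensional function on a
  finite index set, so that there are only countably many possible values. Dyadic grids are used
  because each refines the previous one.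
\<close>

definition increments :: "nat \<Rightarrow> 'a \<Rightarrow> nat \<times> nat \<Rightarrow> nat" where
  "increments n \<omega> = (\<lambda>(i, j)\<in>{1..k} \<times> {..<2 ^ n}.
     N (grid T (2 ^ n) (Suc j)) i \<omega> - N (grid T (2 ^ n) j) i \<omega>)"

definition increment_arrays :: "nat \<Rightarrow> (nat \<times> nat \<Rightarrow> nat) set" where
  "increment_arrays n = ({1..k} \<times> {..<2 ^ n}) \<rightarrow>\<^sub>E UNIV"

definition grid_algebra :: "nat \<Rightarrow> 'a measure" where
  "grid_algebra n = vimage_algebra (space M) (increments n) (count_space (increment_arrays n))"

definition fused_grid_likelihood :: "nat \<Rightarrow> (nat \<times> nat \<Rightarrow> nat) \<Rightarrow> real" where
  "fused_grid_likelihood n v =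
     (\<Prod>i=1..k. grid_likelihood T (2 ^ n) (\<beta> i) (\<nu> i) (\<lambda>j. v (i, j)))"

abbreviation "L \<equiv> fused_likelihood k T \<beta> \<nu> N"
abbreviation "observations \<equiv> natural_filtration (space M) {1..k} N"

lemma path: "i \<in> {1..k} \<Longrightarrow> \<omega> \<in> space M \<Longrightarrow> counting_path T (\<lambda>t. N t i \<omega>)"
  using counting by (simp add: counting_process_def)

lemma space_P0: "space P0 = space M" and space_P1: "space P1 = space M"
  by (rule sets_eq_imp_space_eq[OF sets_P0], rule sets_eq_imp_space_eq[OF sets_P1])

lemma measurable_N: "i \<in> {1..k} \<Longrightarrow> t \<in> {0..T} \<Longrightarrow> N t i \<in> M \<rightarrow>\<^sub>M count_space UNIV"
  using counting by (simp add: counting_process_def)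

lemma grid_in: "j \<le> 2 ^ n \<Longrightarrow> grid T (2 ^ n) j \<in> {0..T}"
  using T grid_nonneg[of T "2 ^ n" j] grid_le[of T "2 ^ n" j] by auto

lemma increments_in: "increments n \<omega> \<in> increment_arrays n"
  by (simp add: increments_def increment_arrays_def)

lemma countable_increment_arrays: "countable (increment_arrays n)"
  unfolding increment_arrays_def by (intro countable_PiE) auto

lemma increments_eq_iff:
  assumes "v \<in> increment_arrays n"
  shows "increments n \<omega> = v \<longleftrightarrow>
    (\<forall>i\<in>{1..k}. \<forall>j<2 ^ n. N (grid T (2 ^ n) (Suc j)) i \<omega> - N (grid T (2 ^ n) j) i \<omega> = v (i, j))"
    (is "_ \<longleftrightarrow> ?R")
proof
  assume ?R
  then show "increments n \<omega> = v"
    using assms by (intro PiE_ext[OF increments_in[unfolded increment_arrays_def]])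
      (auto simp: increments_def increment_arrays_def)
qed (auto simp: increments_def)

lemma measurable_increments:
  assumes "space H = space M"
    and N: "\<And>i j. i \<in> {1..k} \<Longrightarrow> j \<le> 2 ^ n \<Longrightarrow> N (grid T (2 ^ n) j) i \<in> H \<rightarrow>\<^sub>M count_space UNIV"
  shows "increments n \<in> H \<rightarrow>\<^sub>M count_space (increment_arrays n)"
  unfolding measurable_count_space_eq_countable[OF countable_increment_arrays]
proof (intro conjI ballI)
  fix v assume v: "v \<in> increment_arrays n"
  have "{\<omega>\<in>space H. N (grid T (2 ^ n) (Suc j)) i \<omega> - N (grid T (2 ^ n) j) i \<omega> = v (i, j)} \<in> sets H"
    if "i \<in> {1..k}" "j \<in> {..<2 ^ n}" for i j
  proof -
    have [measurable]: "N (grid T (2 ^ n) j) i \<in> H \<rightarrow>\<^sub>M count_space UNIV"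
      "N (grid T (2 ^ n) (Suc j)) i \<in> H \<rightarrow>\<^sub>M count_space UNIV"
      using that by (auto intro!: N)
    show ?thesis by measurable
  qed
  then have "{\<omega>\<in>space H. \<forall>i\<in>{1..k}. \<forall>j\<in>{..<2 ^ n}.
      N (grid T (2 ^ n) (Suc j)) i \<omega> - N (grid T (2 ^ n) j) i \<omega> = v (i, j)} \<in> sets H"
    by (intro sets.sets_Collect_finite_All) auto
  also have "{\<omega>\<in>space H. \<forall>i\<in>{1..k}. \<forall>j\<in>{..<2 ^ n}.
      N (grid T (2 ^ n) (Suc j)) i \<omega> - N (grid T (2 ^ n) j) i \<omega> = v (i, j)} =
      increments n -` {v} \<inter> space H"
    using increments_eq_iff[OF v] by auto
  finally show "increments n -` {v} \<inter> space H \<in> sets H" .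
qed (use increments_in in auto)

lemma measurable_natural_filtration:
  assumes "i \<in> {1..k}" "t \<in> {0..T}"
  shows "N t i \<in> observations T \<rightarrow>\<^sub>M count_space UNIV"
  unfolding natural_filtration_def using assms
  by (intro measurableI) (auto simp: space_measure_of_conv intro!: in_measure_of)

lemma sets_natural_filtration: "sets (observations T) \<subseteq> sets M"
proof -
  have "N s i -` B \<inter> space M \<in> sets M" if "s \<in> {0..T}" "i \<in> {1..k}" for s i B
    using measurable_N[OF that(2,1)] by (rule measurable_sets) simp
  then show ?thesis
    unfolding natural_filtration_def by (subst sigma_le_sets) auto
qed

lemma measurable_observations_P1:
  fixes f :: "'a \<Rightarrow> real"
  assumes "f \<in> borel_measurable (observations T)"
  shows "f \<in> borel_measurable P1"
proof (rule measurableI)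
  fix B :: "real set" assume "B \<in> sets borel"
  then have "f -` B \<inter> space M \<in> sets (observations T)"
    using measurable_sets[OF assms] by (simp only: space_natural_filtration)
  then show "f -` B \<inter> space P1 \<in> sets P1"
    using sets_natural_filtration by (auto simp: space_P1 sets_P1)
qed simp

lemma space_grid_algebra: "space (grid_algebra n) = space M"
  by (simp add: grid_algebra_def)

text \<open>
  Paths are monotone and start at \<open>0\<close>, so the truncated differences of natural numbers are true
  differences and their partial sums return the counts at the grid points.
\<close>

lemma measurable_grid_algebra:
  assumes i: "i \<in> {1..k}" and "j \<le> 2 ^ n"
  shows "N (grid T (2 ^ n) j) i \<in> grid_algebra n \<rightarrow>\<^sub>M count_space UNIV"
proof -
  have inc: "increments n \<in> grid_algebra n \<rightarrow>\<^sub>M count_space (increment_arrays n)"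
    unfolding grid_algebra_def by (rule measurable_vimage_algebra1) (use increments_in in auto)
  have [measurable]: "(\<lambda>\<omega>. increments n \<omega> (i, l)) \<in> grid_algebra n \<rightarrow>\<^sub>M count_space UNIV" for l
    by (rule measurable_compose[OF inc]) simp
  have eq: "(\<Sum>l<j. increments n \<omega> (i, l)) = N (grid T (2 ^ n) j) i \<omega>" if \<omega>: "\<omega> \<in> space M" for \<omega>
    using \<open>j \<le> 2 ^ n\<close>
  proof (induction j)
    case 0
    then show ?case using path[OF i \<omega>] by (simp add: counting_path_def)
  next
    case (Suc j)
    have "N (grid T (2 ^ n) j) i \<omega> \<le> N (grid T (2 ^ n) (Suc j)) i \<omega>"
      using path[OF i \<omega>] Suc.prems grid_in[of j n] grid_in[of "Suc j" n] grid_mono[of T j "Suc j" "2 ^ n"] T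
      by (auto simp: counting_path_def mono_on_def)
    then show ?case using Suc i by (simp add: increments_def)
  qed
  have "(\<lambda>\<omega>. \<Sum>l<j. increments n \<omega> (i, l)) \<in> grid_algebra n \<rightarrow>\<^sub>M count_space UNIV"
    by measurable
  then show ?thesis
    by (rule measurable_cong[THEN iffD1, rotated]) (simp add: eq space_grid_algebra)
qed

lemma grid_algebra_mono:
  assumes "m \<le> n"
  shows "sets (grid_algebra m) \<subseteq> sets (grid_algebra n)"
proof -
  have "increments m \<in> grid_algebra n \<rightarrow>\<^sub>M count_space (increment_arrays m)"
  proof (rule measurable_increments)
    fix i j assume "i \<in> {1..k}" "j \<le> (2::nat) ^ m"
    moreover have "j * 2 ^ (n - m) \<le> 2 ^ m * 2 ^ (n - m)"
      using \<open>j \<le> 2 ^ m\<close> by (intro mult_right_mono) auto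
    then have "j * 2 ^ (n - m) \<le> 2 ^ n" using assms by (simp flip: power_add)
    ultimately show "N (grid T (2 ^ m) j) i \<in> grid_algebra n \<rightarrow>\<^sub>M count_space UNIV"
      unfolding grid_refine[OF assms] by (intro measurable_grid_algebra)
  qed (rule space_grid_algebra)
  then show ?thesis
    unfolding grid_algebra_def[of m] by (intro sets_image_in_sets space_grid_algebra)
qed

lemma strict_mono_power_2: "strict_mono (\<lambda>n. 2 ^ n :: nat)"
  by (simp add: strict_mono_Suc_iff)

text \<open>
  By right-continuity, \<open>N t i\<close> takes a value exactly if the counts at the grid points at or just
  after \<open>t\<close> eventually have this value, which is an event for the grid observations.
\<close>

lemma natural_filtration_generated_by_grids:
  "sets (observations T) \<subseteq> sigma_sets (space M) (\<Union>n. sets (grid_algebra n))"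
proof -
  define H where "H = sigma (space M) (\<Union>n. sets (grid_algebra n))"
  have sub: "(\<Union>n. sets (grid_algebra n)) \<subseteq> Pow (space M)"
    using sets.space_closed[of "grid_algebra _"] by (auto simp: space_grid_algebra)
  then have H: "space H = space M" "sets H = sigma_sets (space M) (\<Union>n. sets (grid_algebra n))"
    by (simp_all add: H_def)
  have grid_H: "N (grid T (2 ^ n) j) i \<in> H \<rightarrow>\<^sub>M count_space UNIV"
    if "i \<in> {1..k}" "j \<le> 2 ^ n" for i j n
    using measurable_grid_algebra[OF that] H
    by (auto simp: measurable_def space_grid_algebra)
  have N_H: "N t i \<in> H \<rightarrow>\<^sub>M count_space UNIV" if t: "t \<in> {0..T}" and i: "i \<in> {1..k}" for t i
  proof (cases "t = 0")
    case True
    then show ?thesis using grid_H[OF i, of 0 0] by simp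
  next
    case False
    define d where "d n = grid T (2 ^ n) (Suc (cell T (2 ^ n) t))" for n
    have [measurable]: "N (d n) i \<in> H \<rightarrow>\<^sub>M count_space UNIV" for n
      unfolding d_def using cell_bounds(3)[of T "2 ^ n" t] t T False by (intro grid_H i) auto
    have "N t i -` {a} \<inter> space H = {\<omega>\<in>space H. \<exists>m. \<forall>n\<ge>m. N (d n) i \<omega> = a}" for a
    proof -
      have "N t i \<omega> = a \<longleftrightarrow> (\<exists>m. \<forall>n\<ge>m. N (d n) i \<omega> = a)" if "\<omega> \<in> space M" for \<omega>
      proof -
        have "\<forall>\<^sub>F n in sequentially. N (d n) i \<omega> = N t i \<omega>"
          unfolding d_def using t False
          by (intro eventually_subseq[OF strict_mono_power_2]
              counting_path_on_fine_grid[OF path[OF i that]]) auto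
        then obtain m where "\<forall>n\<ge>m. N (d n) i \<omega> = N t i \<omega>" by (auto simp: eventually_sequentially)
        then show ?thesis by (metis nle_le)
      qed
      then show ?thesis using H by auto
    qed
    moreover have "{\<omega>\<in>space H. \<exists>m. \<forall>n\<ge>m. N (d n) i \<omega> = a} \<in> sets H" for a
      by measurable
    ultimately show ?thesis by (simp add: measurable_count_space_eq2_countable)
  qed
  have "sets (observations T) \<subseteq> sets H"
    unfolding natural_filtration_def
    by (subst sigma_le_sets) (use sets.top[of H] in \<open>auto simp: H(1)[symmetric] intro!: measurable_sets[OF N_H]\<close>)
  then show ?thesis by (simp add: H)
qed

text \<open>
  Independence across sensors and cells turns the mass of each array of increments into a product of
  Poisson masses, and changing \<open>\<beta>\<close> into \<open>\<beta> + \<nu>\<close> multiplies it by the grid likelihood.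
\<close>

lemma grid_likelihood_is_density:
  assumes "A \<in> sets (grid_algebra n)"
  shows "emeasure P0 A =
    (\<integral>\<^sup>+\<omega>. ennreal (1 / fused_grid_likelihood n (increments n \<omega>)) * indicator A \<omega> \<partial>P1)"
proof (rule countable_likelihood_ratio[where z = "\<lambda>v. ennreal (1 / fused_grid_likelihood n v)"])
  interpret P0: prob_space P0 by (rule P0)
  interpret P1: prob_space P1 by (rule P1)
  show "increments n \<in> P0 \<rightarrow>\<^sub>M count_space (increment_arrays n)"
    by (rule measurable_increments[OF space_P0])
      (subst measurable_cong_sets[OF sets_P0 refl], intro measurable_N grid_in)
  show "A \<in> sets (vimage_algebra (space P1) (increments n) (count_space (increment_arrays n)))"
    using assms by (simp add: grid_algebra_def space_P1)
  fix v assume v: "v \<in> increment_arrays n"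
  let ?t = "grid T (2 ^ n)"
  define b where "b = (\<Prod>i\<in>{1..k}. \<Prod>j<2 ^ n. poisson_mass (LBINT u:{?t j..?t (Suc j)}. \<beta> i u) (v (i, j)))"
  have mono: "?t j \<le> ?t (Suc j)" for j
    using T by (simp add: grid_mono)
  have pre: "increments n -` {v} \<inter> space P = {\<omega>\<in>space P. \<forall>i\<in>{1..k}. \<forall>j<2 ^ n.
      N (?t (Suc j)) i \<omega> - N (?t j) i \<omega> = v (i, j)}" for P :: "'a measure"
    using increments_eq_iff[OF v] by auto
  have "measure P0 (increments n -` {v} \<inter> space P0) = b"
    unfolding pre b_def
    by (rule independent_poisson_increments[where t = ?t, OF pp0 ind0 P0 _ _ grid_in mono]) (use k in auto)
  moreover have "measure P1 (increments n -` {v} \<inter> space P1) = (\<Prod>i\<in>{1..k}. \<Prod>j<2 ^ n.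
      poisson_mass (LBINT u:{?t j..?t (Suc j)}. \<beta> i u + \<nu> i u) (v (i, j)))"
    unfolding pre
    by (rule independent_poisson_increments[where t = ?t, OF pp1 ind1 P1 _ _ grid_in mono]) (use k in auto)
  moreover have "\<dots> = fused_grid_likelihood n v * b"
    unfolding b_def fused_grid_likelihood_def prod.distrib[symmetric]
    by (intro prod.cong refl grid_likelihood_changes_poisson_masses T \<beta>_cont \<nu>_cont \<beta>_pos) auto
  moreover have "0 < fused_grid_likelihood n v"
    unfolding fused_grid_likelihood_def using \<beta>_pos \<nu>_nonneg T
    by (intro prod_pos less_le_trans[OF exp_gt_zero grid_likelihood_ge]) (auto simp: less_imp_le)
  ultimately show "emeasure P0 (increments n -` {v} \<inter> space P0) =
      ennreal (1 / fused_grid_likelihood n v) * emeasure P1 (increments n -` {v} \<inter> space P1)"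
    by (simp add: P0.emeasure_eq_measure P1.emeasure_eq_measure flip: ennreal_mult')
qed (auto simp: countable_increment_arrays sets_P0 sets_P1)

lemma measurable_fused_grid_likelihood:
  "(\<lambda>\<omega>. fused_grid_likelihood n (increments n \<omega>)) \<in> borel_measurable (observations T)"
proof -
  have "increments n \<in> observations T \<rightarrow>\<^sub>M count_space (increment_arrays n)"
    by (intro measurable_increments measurable_natural_filtration grid_in)
      (auto simp: space_natural_filtration)
  then show ?thesis by (rule measurable_compose) simp
qed

lemma fused_grid_likelihood_tendsto:
  assumes "\<omega> \<in> space M"
  shows "(\<lambda>n. fused_grid_likelihood n (increments n \<omega>)) \<longlonglongrightarrow> L \<omega>"
proof -
  have "(\<lambda>n. \<Prod>i=1..k. grid_likelihood T (2 ^ n) (\<beta> i) (\<nu> i)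
      (\<lambda>j. N (grid T (2 ^ n) (Suc j)) i \<omega> - N (grid T (2 ^ n) j) i \<omega>)) \<longlonglongrightarrow> L \<omega>"
    unfolding fused_likelihood_def
    by (intro tendsto_prod LIMSEQ_subseq_LIMSEQ[OF grid_likelihood_tendsto strict_mono_power_2,
          unfolded comp_def] path assms T \<beta>_cont \<nu>_cont \<beta>_pos)
  moreover have "fused_grid_likelihood n (increments n \<omega>) = (\<Prod>i=1..k. grid_likelihood T (2 ^ n) (\<beta> i) (\<nu> i)
      (\<lambda>j. N (grid T (2 ^ n) (Suc j)) i \<omega> - N (grid T (2 ^ n) j) i \<omega>))" for n
    unfolding fused_grid_likelihood_def grid_likelihood_def
    by (intro prod.cong refl arg_cong2[where f = "(*)"]) (simp add: increments_def)
  ultimately show ?thesis by (simp only:)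
qed

lemma measurable_fused_likelihood: "L \<in> borel_measurable (observations T)"
proof (rule borel_measurable_LIMSEQ_real)
  show "(\<lambda>n. fused_grid_likelihood n (increments n \<omega>)) \<longlonglongrightarrow> L \<omega>" if "\<omega> \<in> space (observations T)" for \<omega>
    using that fused_grid_likelihood_tendsto by (simp add: space_natural_filtration)
qed (rule measurable_fused_grid_likelihood)

lemma fused_likelihood_pos: "\<omega> \<in> space M \<Longrightarrow> 0 < L \<omega>"
  unfolding fused_likelihood_def
  by (intro prod_pos sensor_likelihood_pos path T \<beta>_pos \<nu>_nonneg) auto

text \<open>
  The limit of the densities on the grid \<sigma>-algebras, taken under \<open>P1\<close> because there the densities
  \<open>1 / fused_grid_likelihood\<close> are bounded by the product over the sensors of \<open>exp (\<integral> \<nu> i)\<close>.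
\<close>

lemma inverse_likelihood_is_density:
  assumes "A \<in> sets (observations T)"
  shows "emeasure P0 A = (\<integral>\<^sup>+\<omega>. ennreal (1 / L \<omega>) * indicator A \<omega> \<partial>P1)"
proof (rule density_on_generated_algebra[where G = grid_algebra and
      Z = "\<lambda>n \<omega>. ennreal (1 / fused_grid_likelihood n (increments n \<omega>))" and
      c = "\<Prod>i=1..k. exp (LBINT s:{0..T}. \<nu> i s)"])
  interpret P0: prob_space P0 by (rule P0)
  interpret P1: prob_space P1 by (rule P1)
  show "finite_measure P0" "finite_measure P1" by unfold_locales
  show "sets P0 = sets P1" by (simp add: sets_P0 sets_P1)
  note [measurable] = measurable_observations_P1[OF measurable_fused_grid_likelihood]
    measurable_observations_P1[OF measurable_fused_likelihood]
  show "(\<lambda>\<omega>. ennreal (1 / fused_grid_likelihood n (increments n \<omega>))) \<in> borel_measurable P1" for n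
    by measurable
  show "(\<lambda>\<omega>. ennreal (1 / L \<omega>)) \<in> borel_measurable P1"
    by measurable
  show "subalgebra P1 (grid_algebra n)" for n
  proof -
    have "increments n \<in> M \<rightarrow>\<^sub>M count_space (increment_arrays n)"
      by (intro measurable_increments measurable_N grid_in refl)
    then have "sets (grid_algebra n) \<subseteq> sets M"
      unfolding grid_algebra_def by (intro sets_image_in_sets) auto
    then show ?thesis by (simp add: subalgebra_def space_P1 sets_P1 space_grid_algebra)
  qed
  show "sets (grid_algebra m) \<subseteq> sets (grid_algebra n)" if "m \<le> n" for m n
    using that by (rule grid_algebra_mono)
  show "emeasure P0 A = (\<integral>\<^sup>+\<omega>. ennreal (1 / fused_grid_likelihood n (increments n \<omega>)) * indicator A \<omega> \<partial>P1)"
    if "A \<in> sets (grid_algebra n)" for A n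
    using that by (rule grid_likelihood_is_density)
  show "ennreal (1 / fused_grid_likelihood n (increments n \<omega>)) \<le> ennreal (\<Prod>i=1..k. exp (LBINT s:{0..T}. \<nu> i s))"
    for n \<omega>
  proof (rule ennreal_leI)
    have bnd: "1 / grid_likelihood T (2 ^ n) (\<beta> i) (\<nu> i) v \<le> exp (LBINT s:{0..T}. \<nu> i s)
        \<and> 0 < grid_likelihood T (2 ^ n) (\<beta> i) (\<nu> i) v" if "i \<in> {1..k}" for i v
    proof -
      have "exp (- (LBINT s:{0..T}. \<nu> i s)) \<le> grid_likelihood T (2 ^ n) (\<beta> i) (\<nu> i) v"
        using that \<beta>_pos \<nu>_nonneg T by (intro grid_likelihood_ge) (auto simp: less_imp_le)
      moreover from this have "0 < grid_likelihood T (2 ^ n) (\<beta> i) (\<nu> i) v"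
        by (rule less_le_trans[OF exp_gt_zero])
      ultimately show ?thesis by (simp add: exp_minus field_simps)
    qed
    show "1 / fused_grid_likelihood n (increments n \<omega>) \<le> (\<Prod>i=1..k. exp (LBINT s:{0..T}. \<nu> i s))"
      unfolding fused_grid_likelihood_def
    proof -
      have "1 / (\<Prod>i=1..k. g i) = (\<Prod>i=1..k. 1 / g i)" for g :: "nat \<Rightarrow> real"
        by (simp add: prod_dividef)
      then show "1 / (\<Prod>i=1..k. grid_likelihood T (2 ^ n) (\<beta> i) (\<nu> i) (\<lambda>j. increments n \<omega> (i, j)))
          \<le> (\<Prod>i=1..k. exp (LBINT s:{0..T}. \<nu> i s))"
        using bnd by (auto intro!: prod_mono simp: less_imp_le)
    qed
  qed
  show "(\<lambda>n. ennreal (1 / fused_grid_likelihood n (increments n \<omega>))) \<longlonglongrightarrow> ennreal (1 / L \<omega>)"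
    if "\<omega> \<in> space P1" for \<omega>
    using that fused_likelihood_pos[of \<omega>]
    by (intro tendsto_ennrealI tendsto_divide tendsto_const fused_grid_likelihood_tendsto) (auto simp: space_P1)
  show "A \<in> sigma_sets (space P1) (\<Union>n. sets (grid_algebra n))"
    using assms natural_filtration_generated_by_grids by (auto simp: space_P1)
qed

end

section \<open>Optimality of the likelihood ratio test\<close>

theorem theorem1:
  fixes k :: nat and T \<beta>min \<beta>max \<nu>min \<nu>max \<alpha> \<gamma> :: real
    and \<beta> \<nu> :: "nat \<Rightarrow> real \<Rightarrow> real"
    and M P0 P1 :: "'a measure"
    and N :: "real \<Rightarrow> nat \<Rightarrow> 'a \<Rightarrow> nat"
  defines "FN \<equiv> natural_filtration (space M) {1..k} N"
  defines "A_star \<equiv> {\<omega> \<in> space M. fused_likelihood k T \<beta> \<nu> N \<omega> \<ge> \<gamma>}"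
  assumes "k \<ge> 1" and "T > 0"
    and "0 < \<beta>min" and "\<beta>min < \<beta>max" and "0 < \<nu>min" and "\<nu>min < \<nu>max"
    and "\<And>i. i \<in> {1..k} \<Longrightarrow> continuous_on {0..T} (\<beta> i)"
    and "\<And>i. i \<in> {1..k} \<Longrightarrow> \<beta> i ` {0..T} \<subseteq> {\<beta>min..\<beta>max}"
    and "\<And>i. i \<in> {1..k} \<Longrightarrow> continuous_on {0..T} (\<nu> i)"
    and "\<And>i. i \<in> {1..k} \<Longrightarrow> \<nu> i ` {0..T} \<subseteq> {\<nu>min..\<nu>max}"
    and "\<And>i. i \<in> {1..k} \<Longrightarrow> counting_process M T (\<lambda>t. N t i)"
    and "prob_space P0" and "sets P0 = sets M"
    and "prob_space P1" and "sets P1 = sets M"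
    and "\<And>i. i \<in> {1..k} \<Longrightarrow> poisson_process P0 FN T (\<beta> i) (\<lambda>t. N t i)"
    and "indep_processes P0 T {1..k} N"
    and "\<And>i. i \<in> {1..k} \<Longrightarrow> poisson_process P1 FN T (\<lambda>t. \<beta> i t + \<nu> i t) (\<lambda>t. N t i)"
    and "indep_processes P1 T {1..k} N"
    and "0 < \<alpha>" and "\<alpha> < 1" and "\<gamma> > 0"
    and "measure P0 A_star = \<alpha>"
  shows "A_star \<in> sets (FN T) \<and>
    (\<forall>A1 \<in> sets (FN T). measure P0 A1 \<le> \<alpha> \<longrightarrow> measure P1 A_star \<ge> measure P1 A1)"
proof -
  have \<beta>_pos': "0 < \<beta> i s" if "i \<in> {1..k}" "s \<in> {0..T}" for i s
  proof -
    have "\<beta> i s \<in> {\<beta>min..\<beta>max}" using assms(10)[OF that(1)] that(2) by blast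
    then show ?thesis using \<open>0 < \<beta>min\<close> by simp
  qed
  have \<nu>_nonneg': "0 \<le> \<nu> i s" if "i \<in> {1..k}" "s \<in> {0..T}" for i s
  proof -
    have "\<nu> i s \<in> {\<nu>min..\<nu>max}" using assms(12)[OF that(1)] that(2) by blast
    then show ?thesis using \<open>0 < \<nu>min\<close> by simp
  qed
  interpret poisson_hypotheses k T \<beta> \<nu> M P0 P1 N
    by (rule poisson_hypotheses.intro) (fact assms[unfolded FN_def] \<beta>_pos' \<nu>_nonneg')+
  have A_star: "A_star = {\<omega>\<in>space P1. \<gamma> \<le> L \<omega>}"
    by (simp add: A_star_def space_P1)
  have "{\<omega>\<in>space (FN T). \<gamma> \<le> L \<omega>} \<in> sets (FN T)"
    using measurable_fused_likelihood unfolding FN_def by measurable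
  then have A_star_in: "A_star \<in> sets (FN T)"
    by (simp add: A_star_def FN_def space_natural_filtration)
  moreover have "measure P1 A1 \<le> measure P1 A_star"
    if "A1 \<in> sets (FN T)" "measure P0 A1 \<le> \<alpha>" for A1
    unfolding A_star
  proof (rule neyman_pearson[where F = "FN T" and P = P0])
    show "L \<in> borel_measurable P1"
      by (rule measurable_observations_P1[OF measurable_fused_likelihood])
    show "0 < L \<omega>" if "\<omega> \<in> space P1" for \<omega>
      using that by (simp add: space_P1 fused_likelihood_pos)
    show "emeasure P0 A = (\<integral>\<^sup>+\<omega>. ennreal (1 / L \<omega>) * indicator A \<omega> \<partial>P1)"
      if "A \<in> sets (FN T)" for A
      using that unfolding FN_def by (rule inverse_likelihood_is_density)
    show "sets (FN T) \<subseteq> sets P1"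
      using sets_natural_filtration by (simp add: FN_def sets_P1)
    show "measure P0 A1 \<le> measure P0 {\<omega>\<in>space P1. \<gamma> \<le> L \<omega>}"
      using that \<open>measure P0 A_star = \<alpha>\<close> by (simp flip: A_star)
    show "{\<omega>\<in>space P1. \<gamma> \<le> L \<omega>} \<in> sets (FN T)"
      using A_star_in by (simp flip: A_star)
  qed (use that assms P0 P1 in simp_all)
  ultimately show ?thesis by blast
qed

end
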